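(* Let $G$ be an Abelian group (written multiplicatively), $R$ a commutative ring with unity, and $\varphi:\mathbb{Z}^d\to G$ a homomorphism; let $\varphi':\mathbb{Z}^d\to G$ be the homomorphism $\varphi'(\alpha)=\varphi(\alpha)^{-1}$. Let $\Delta$ be a $d$-dimensional half-open simplex with vertices $v_1,\dots,v_{d+1}\in\mathbb{Z}^d$, and let $\Delta'$ be the half-open simplex with the same vertices and the complementary set of facets removed. Then $$h^*(\Delta',\varphi;t)=\varphi(v_1+\dots+v_{d+1})\,t^{d+1}\,h^*(\Delta,\varphi';1/t).$$ Moreover, as rational functions in $t$ over $R[G]$, $$\mathcal E(\Delta,\varphi';t^{-1})=(-1)^{d+1}\mathcal E(\Delta',\varphi;t).$$
   Context: $R[G]$ is the group ring. A $d$-dimensional half-open simplex with vertices $v_1,\dots,v_{d+1}$ (affinely independent) is a set $\Delta=\{\sum_i\lambda_iv_i:\sum_i\lambda_i=1,\ \lambda_i>0\ (i\in S),\ \lambda_i\ge0\ (i\notin S)\}$ for some $S\subseteq\{1,\dots,d+1\}$ (the facets opposite $v_i$, $i\in S$, are removed); $\Delta'$ is the same with $S$ replaced by its complement. For such $\Delta$, with $u_i=(v_i,1)\in\mathbb{Z}^{d+1}$, its fundamental parallelepiped is $\Pi=\{\sum_i\lambda_iu_i:\lambda_i\in(0,1]\ (i\in S),\ \lambda_i\in[0,1)\ (i\notin S)\}$, and its $h^*_\varphi$-polynomial is $h^*(\Delta,\varphi;t)=\sum_{(\beta,m)\in\Pi\cap\mathbb{Z}^{d+1}}\varphi(\beta)t^m\in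 R[G][t]$. With $n\Delta=\{\sum_i\lambda_iv_i:\sum_i\lambda_i=n,\ \text{same strict/weak conditions}\}$, the $\varphi$-Ehrhart series is $\mathcal E(\Delta,\varphi;t)=\sum_{n\ge0}\big(\sum_{\alpha\in n\Delta\cap\mathbb{Z}^d}\varphi(\alpha)\big)t^n$, which equals the rational function $h^*(\Delta,\varphi;t)/\prod_{i=1}^{d+1}(1-\varphi(v_i)t)$; $\mathcal E(\Delta,\varphi';t^{-1})$ means this rational function (for $\varphi'$) with $t$ replaced by $t^{-1}$. *)

theory Defs
  imports
    "HOL-Analysis.Analysis"
    "HOL-Library.Poly_Mapping"
    "HOL-Computational_Algebra.Polynomial_FPS"
begin

section \<open>The total ring of fractions of a commutative ring\<close>

text \<open>
  A group ring need not be an integral domain, so \<open>'a fract\<close> is not available for rational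
  functions over it.  Rational functions are taken in the total ring of fractions of the polynomial
  ring: fractions whose denominators are arbitrary non-zero-divisors.
\<close>

definition nonzerodivisor :: "'a::comm_ring_1 \<Rightarrow> bool" where
  "nonzerodivisor b \<longleftrightarrow> (\<forall>x. b * x = 0 \<longrightarrow> x = 0)"

lemma nonzerodivisorI: "(\<And>x. b * x = 0 \<Longrightarrow> x = 0) \<Longrightarrow> nonzerodivisor b"
  by (simp add: nonzerodivisor_def)

lemma nonzerodivisorD: "nonzerodivisor b \<Longrightarrow> b * x = 0 \<Longrightarrow> x = 0"
  unfolding nonzerodivisor_def by blast

lemma nonzerodivisor_1 [simp]: "nonzerodivisor 1"
  by (rule nonzerodivisorI) simp

lemma nonzerodivisor_mult [simp]:
  assumes "nonzerodivisor a" "nonzerodivisor b"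
  shows "nonzerodivisor (a * b)"
proof (rule nonzerodivisorI)
  fix x assume "a * b * x = 0"
  then have "a * (b * x) = 0" by (simp only: mult.assoc)
  then show "x = 0" using assms by (blast dest: nonzerodivisorD)
qed

lemma nonzerodivisor_cancel:
  assumes "nonzerodivisor b" "b * x = b * y"
  shows "x = y"
proof -
  have "b * (x - y) = 0" using assms(2) by (simp add: right_diff_distrib)
  then have "x - y = 0" by (rule nonzerodivisorD[OF assms(1)])
  then show ?thesis by simp
qed

definition tfractrel :: "'a::comm_ring_1 \<times> 'a \<Rightarrow> 'a \<times> 'a \<Rightarrow> bool" where
  "tfractrel x y \<longleftrightarrow>
     nonzerodivisor (snd x) \<and> nonzerodivisor (snd y) \<and> fst x * snd y = fst y * snd x"

lemma part_equivp_tfractrel: "part_equivp tfractrel"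
proof (rule part_equivpI)
  show "\<exists>x::'a \<times> 'a. tfractrel x x"
    by (rule exI[where x = "(0, 1)"]) (simp add: tfractrel_def)
  show "symp (tfractrel :: 'a \<times> 'a \<Rightarrow> _)"
    by (simp add: symp_def tfractrel_def)
  show "transp (tfractrel :: 'a \<times> 'a \<Rightarrow> _)"
  proof (rule transpI, unfold split_paired_all)
    fix a b a' b' a'' b'' :: 'a
    assume A: "tfractrel (a, b) (a', b')" and B: "tfractrel (a', b') (a'', b'')"
    have "b' * (a * b'') = b'' * (a * b')" by (simp add: ac_simps)
    also have "a * b' = a' * b" using A by (simp add: tfractrel_def)
    also have "b'' * (a' * b) = b * (a' * b'')" by (simp add: ac_simps)
    also have "a' * b'' = a'' * b'" using B by (simp add: tfractrel_def)
    also have "b * (a'' * b') = b' * (a'' * b)" by (simp add: ac_simps)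
    finally have "b' * (a * b'') = b' * (a'' * b)" .
    moreover have "nonzerodivisor b'" using A by (simp add: tfractrel_def)
    ultimately have "a * b'' = a'' * b" by (rule nonzerodivisor_cancel[rotated])
    then show "tfractrel (a, b) (a'', b'')" using A B by (simp add: tfractrel_def)
  qed
qed

quotient_type (overloaded) 'a total_fract = "'a::comm_ring_1 \<times> 'a" / partial: "tfractrel"
  by (rule part_equivp_tfractrel)

lift_definition tfract :: "'a::comm_ring_1 \<Rightarrow> 'a \<Rightarrow> 'a total_fract"
  is "\<lambda>a b. if nonzerodivisor b then (a, b) else (0, 1)"
  by (simp add: tfractrel_def)

lemma tfract_cases [cases type: total_fract]:
  obtains (tfract) a b where "q = tfract a b" "nonzerodivisor b"
  by transfer (auto simp: tfractrel_def)

lemma tfract_eq_iff: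
  "nonzerodivisor b \<Longrightarrow> nonzerodivisor d \<Longrightarrow> tfract a b = tfract c d \<longleftrightarrow> a * d = c * b"
  by transfer (simp add: tfractrel_def)

instantiation total_fract :: (comm_ring_1) comm_ring_1
begin

lift_definition zero_total_fract :: "'a total_fract" is "(0, 1)"
  by (simp add: tfractrel_def)

lift_definition one_total_fract :: "'a total_fract" is "(1, 1)"
  by (simp add: tfractrel_def)

lift_definition plus_total_fract :: "'a total_fract \<Rightarrow> 'a total_fract \<Rightarrow> 'a total_fract"
  is "\<lambda>q r. (fst q * snd r + fst r * snd q, snd q * snd r)"
proof (clarsimp simp: tfractrel_def, goal_cases)
  case (1 a b a' b' c d c' d')
  have "(a * d + c * b) * (b' * d') = (a * b') * d * d' + (c * d') * b * b'"
    by (simp add: algebra_simps)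
  also have "\<dots> = (a' * b) * d * d' + (c' * d) * b * b'"
    using 1 by simp
  finally show ?case by (simp add: algebra_simps)
qed

lift_definition uminus_total_fract :: "'a total_fract \<Rightarrow> 'a total_fract"
  is "\<lambda>x. (- fst x, snd x)"
  by (simp add: tfractrel_def)

definition minus_total_fract :: "'a total_fract \<Rightarrow> 'a total_fract \<Rightarrow> 'a total_fract"
  where "q - r = q + - (r :: 'a total_fract)"

lift_definition times_total_fract :: "'a total_fract \<Rightarrow> 'a total_fract \<Rightarrow> 'a total_fract"
  is "\<lambda>q r. (fst q * fst r, snd q * snd r)"
proof (clarsimp simp: tfractrel_def, goal_cases)
  case (1 a b a' b' c d c' d')
  have "a * c * (b' * d') = (a * b') * (c * d')" by (simp add: algebra_simps)
  also have "\<dots> = (a' * b) * (c' * d)" using 1 by simp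
  finally show ?case by (simp add: algebra_simps)
qed

lemma zero_tfract: "0 = tfract 0 1"
  by transfer (simp add: tfractrel_def)

lemma one_tfract: "1 = tfract 1 1"
  by transfer (simp add: tfractrel_def)

lemma add_tfract:
  "nonzerodivisor b \<Longrightarrow> nonzerodivisor d \<Longrightarrow>
     tfract a b + tfract c d = tfract (a * d + c * b) (b * d)"
  by transfer (simp add: tfractrel_def)

lemma minus_tfract: "nonzerodivisor b \<Longrightarrow> - tfract a b = tfract (- a) b"
  by transfer (simp add: tfractrel_def)

lemma mult_tfract:
  "nonzerodivisor b \<Longrightarrow> nonzerodivisor d \<Longrightarrow>
     tfract a b * tfract c d = tfract (a * c) (b * d)"
  by transfer (simp add: tfractrel_def)

instance
proof
  fix q r s :: "'a total_fract"
  show "(q * r) * s = q * (r * s)"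
    by (cases q, cases r, cases s) (simp add: mult_tfract tfract_eq_iff algebra_simps)
  show "q * r = r * q"
    by (cases q, cases r) (simp add: mult_tfract tfract_eq_iff algebra_simps)
  show "1 * q = q"
    by (cases q) (simp add: one_tfract mult_tfract tfract_eq_iff)
  show "(q + r) + s = q + (r + s)"
    by (cases q, cases r, cases s) (simp add: add_tfract tfract_eq_iff algebra_simps)
  show "q + r = r + q"
    by (cases q, cases r) (simp add: add_tfract tfract_eq_iff algebra_simps)
  show "0 + q = q"
    by (cases q) (simp add: zero_tfract add_tfract tfract_eq_iff)
  show "- q + q = 0"
    by (cases q) (simp add: zero_tfract minus_tfract add_tfract tfract_eq_iff)
  show "q - r = q + - r"
    by (simp add: minus_total_fract_def)
  show "(q + r) * s = q * s + r * s"
    by (cases q, cases r, cases s) (simp add: add_tfract mult_tfract tfract_eq_iff algebra_simps)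
  show "(0::'a total_fract) \<noteq> 1"
    by (simp add: zero_tfract one_tfract tfract_eq_iff)
qed

end

text \<open>Inverses of non-invertible elements are \<open>0\<close>, in analogy with division by zero in a field.\<close>

instantiation total_fract :: (comm_ring_1) inverse
begin

definition inverse_total_fract :: "'a total_fract \<Rightarrow> 'a total_fract" where
  "inverse (x :: 'a total_fract) = (if \<exists>y. x * y = 1 then THE y. x * y = 1 else 0)"

definition divide_total_fract :: "'a total_fract \<Rightarrow> 'a total_fract \<Rightarrow> 'a total_fract" where
  "x div (y :: 'a total_fract) = x * inverse y"

instance ..

end

lemma inverse_total_fract_unique:
  fixes x y :: "'a::comm_ring_1 total_fract"
  assumes "x * y = 1"
  shows "inverse x = y"
proof -
  have "y' = y" if "x * y' = 1" for y'
  proof -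
    have "y' = (x * y) * y'" using assms by simp
    also have "\<dots> = (x * y') * y" by (simp only: mult_ac)
    finally show ?thesis using that by simp
  qed
  then have "(THE y. x * y = 1) = y" using assms by (intro the_equality)
  then show ?thesis using assms by (auto simp: inverse_total_fract_def)
qed

definition of_base :: "'a::comm_ring_1 \<Rightarrow> 'a total_fract" where
  "of_base a = tfract a 1"

lemma of_base_0 [simp]: "of_base 0 = 0"
  and of_base_1 [simp]: "of_base 1 = 1"
  and of_base_add: "of_base (a + b) = of_base a + of_base b"
  and of_base_mult: "of_base (a * b) = of_base a * of_base b"
  and of_base_minus: "of_base (- a) = - of_base a"
  and of_base_eq_iff [simp]: "of_base a = of_base b \<longleftrightarrow> a = b"
  by (simp_all add: of_base_def zero_tfract one_tfract add_tfract mult_tfract minus_tfract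
      tfract_eq_iff)

lemma of_base_eq_0_iff [simp]: "of_base a = 0 \<longleftrightarrow> a = 0"
  using of_base_eq_iff[of a 0] by simp

lemma of_base_power: "of_base (a ^ n) = of_base a ^ n"
  by (induction n) (simp_all add: of_base_mult)

lemma of_base_prod: "of_base (prod f A) = (\<Prod>x\<in>A. of_base (f x))"
  by (induction A rule: infinite_finite_induct) (simp_all add: of_base_mult)

lemma of_base_inverse:
  assumes "nonzerodivisor b"
  shows "of_base b * inverse (of_base b) = 1" "inverse (of_base b) = tfract 1 b"
proof -
  have *: "of_base b * tfract 1 b = 1"
    using assms by (simp add: of_base_def one_tfract mult_tfract tfract_eq_iff)
  then show "inverse (of_base b) = tfract 1 b" by (rule inverse_total_fract_unique)
  with * show "of_base b * inverse (of_base b) = 1" by simp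
qed

lemma tfract_conv_divide:
  assumes "nonzerodivisor b"
  shows "tfract a b = of_base a / of_base b"
  using assms by (simp only: divide_total_fract_def of_base_inverse(2))
    (simp add: of_base_def mult_tfract)


section \<open>Rational functions over a commutative ring\<close>

type_synonym 'a ratfun = "'a poly total_fract"

definition rf_const :: "'a::comm_ring_1 \<Rightarrow> 'a ratfun" where
  "rf_const c = of_base [:c:]"

definition rf_X :: "'a::comm_ring_1 ratfun" where
  "rf_X = of_base [:0, 1:]"

text \<open>\<open>poly_at_inv p\<close> is \<open>p(1 / t)\<close>.\<close>

definition poly_at_inv :: "'a::comm_ring_1 poly \<Rightarrow> 'a ratfun" where
  "poly_at_inv p = poly (map_poly rf_const p) (inverse rf_X)"

text \<open>
  Replacement of the variable \<open>t\<close> by \<open>1 / t\<close>; independence of the chosen fraction is the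
  lemma \<open>invert_var_divide\<close> below.
\<close>

definition invert_var :: "'a::comm_ring_1 ratfun \<Rightarrow> 'a ratfun" where
  "invert_var F = (THE H. \<exists>p q. nonzerodivisor q \<and> F = of_base p / of_base q \<and>
      H = poly_at_inv p / poly_at_inv q)"

lemma rf_const_simps [simp]: "rf_const 0 = 0" "rf_const 1 = 1"
  "rf_const (a + b) = rf_const a + rf_const b" "rf_const (a * b) = rf_const a * rf_const b"
  by (simp_all add: rf_const_def flip: of_base_add of_base_mult one_pCons)

lemma nonzerodivisor_X: "nonzerodivisor ([:0, 1:] :: 'a::comm_ring_1 poly)"
  by (rule nonzerodivisorI) simp

lemma rf_X_inverse: "rf_X * inverse rf_X = (1 :: 'a::comm_ring_1 ratfun)"
  unfolding rf_X_def by (rule of_base_inverse) (rule nonzerodivisor_X)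

lemma rf_X_power_inverse: "rf_X ^ n * inverse rf_X ^ n = (1 :: 'a::comm_ring_1 ratfun)"
  by (simp add: rf_X_inverse flip: power_mult_distrib)

lemma poly_at_inv_pCons [simp]:
  "poly_at_inv (pCons a p) = rf_const a + inverse rf_X * poly_at_inv p"
  by (simp add: poly_at_inv_def map_poly_pCons)

lemma poly_at_inv_0 [simp]: "poly_at_inv 0 = 0"
  by (simp add: poly_at_inv_def)

lemma poly_at_inv_1 [simp]: "poly_at_inv 1 = 1"
  by (simp add: one_pCons)

lemma poly_at_inv_add: "poly_at_inv (p + q) = poly_at_inv p + poly_at_inv q"
  by (induction p q rule: poly_induct2) (simp_all add: algebra_simps)

lemma poly_at_inv_smult: "poly_at_inv (smult c p) = rf_const c * poly_at_inv p"
  by (induction p) (simp_all add: algebra_simps)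

lemma poly_at_inv_mult: "poly_at_inv (p * q) = poly_at_inv p * poly_at_inv q"
  by (induction p) (simp_all add: algebra_simps poly_at_inv_add poly_at_inv_smult)

lemma ex_reversed_poly:
  "\<exists>r n. of_base r = rf_X ^ n * poly_at_inv p \<and> poly_at_inv r = inverse rf_X ^ n * of_base p"
proof (induction p)
  case 0
  show ?case by (rule exI[of _ 0]) simp
next
  case (pCons a p)
  then obtain r n where r: "of_base r = rf_X ^ n * poly_at_inv p"
    "poly_at_inv r = inverse rf_X ^ n * of_base p" by blast
  have mon: "of_base ([:a:] * [:0, 1:] ^ Suc n) = rf_const a * rf_X ^ Suc n"
    by (simp only: of_base_mult of_base_power rf_const_def rf_X_def)
  have mon': "poly_at_inv ([:0, 1:] ^ k) = (inverse rf_X ^ k :: 'a ratfun)" for k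
    by (induction k) (simp_all add: poly_at_inv_mult del: mult_pCons_left)
  have p: "of_base (pCons a p) = rf_const a + rf_X * of_base p"
  proof -
    have "pCons a p = [:a:] + [:0, 1:] * p" by simp
    then show ?thesis by (simp only: of_base_add of_base_mult rf_const_def rf_X_def)
  qed
  have X1: "rf_X ^ Suc n * (inverse rf_X * y) = rf_X ^ n * y" for y :: "'a ratfun"
  proof -
    have "rf_X ^ Suc n * (inverse rf_X * y) = (rf_X * inverse rf_X) * (rf_X ^ n * y)"
      by (simp only: power_Suc mult_ac)
    then show ?thesis by (simp add: rf_X_inverse)
  qed
  have X2: "inverse rf_X ^ Suc n * (rf_X * y) = inverse rf_X ^ n * y" for y :: "'a ratfun"
  proof -
    have "inverse rf_X ^ Suc n * (rf_X * y) = (rf_X * inverse rf_X) * (inverse rf_X ^ n * y)"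
      by (simp only: power_Suc mult_ac)
    then show ?thesis by (simp add: rf_X_inverse)
  qed
  show ?case
  proof (intro exI conjI)
    show "of_base ([:a:] * [:0, 1:] ^ Suc n + r) = rf_X ^ Suc n * poly_at_inv (pCons a p)"
      by (simp only: of_base_add mon poly_at_inv_pCons distrib_left X1 r mult.commute[of "rf_const a"])
    have a: "poly_at_inv [:a:] = rf_const a" by simp
    show "poly_at_inv ([:a:] * [:0, 1:] ^ Suc n + r) = inverse rf_X ^ Suc n * of_base (pCons a p)"
      by (simp only: poly_at_inv_add poly_at_inv_mult[of "[:a:]"] mon' p a distrib_left X2 r
          mult.commute[of "rf_const a"])
  qed
qed

lemma rf_X_power_cancel:
  fixes H :: "'a::comm_ring_1 ratfun"
  shows "rf_X ^ n * H = 0 \<Longrightarrow> H = 0" "inverse rf_X ^ n * H = 0 \<Longrightarrow> H = 0"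
proof -
  have *: "H = inverse rf_X ^ n * (rf_X ^ n * H)" "H = rf_X ^ n * (inverse rf_X ^ n * H)"
    using rf_X_power_inverse[of n, where 'a = 'a]
    by (simp_all add: mult.commute[of "inverse rf_X ^ n" "rf_X ^ n"] flip: mult.assoc)
  show "rf_X ^ n * H = 0 \<Longrightarrow> H = 0" by (subst *(1)) simp
  show "inverse rf_X ^ n * H = 0 \<Longrightarrow> H = 0" by (subst *(2)) simp
qed

lemma poly_at_inv_regular:
  assumes q: "nonzerodivisor q" and H: "poly_at_inv q * of_base a = 0"
  shows "a = 0"
proof -
  obtain r n where r: "of_base r = rf_X ^ n * poly_at_inv q"
    "poly_at_inv r = inverse rf_X ^ n * of_base q" using ex_reversed_poly by blast
  obtain s m where s: "of_base s = rf_X ^ m * poly_at_inv a"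
    "poly_at_inv s = inverse rf_X ^ m * of_base a" using ex_reversed_poly by blast
  have "of_base (r * a) = 0" using H by (simp add: of_base_mult r mult.assoc)
  then have "poly_at_inv (r * a) = 0" by simp
  then have "inverse rf_X ^ n * (of_base q * poly_at_inv a) = 0"
    by (simp add: poly_at_inv_mult r mult.assoc)
  then have "of_base q * poly_at_inv a = 0" by (rule rf_X_power_cancel)
  then have "of_base (q * s) = 0" by (simp add: of_base_mult s mult.left_commute[of "of_base q"])
  then have "q * s = 0" by (simp only: of_base_eq_0_iff)
  then have "s = 0" by (rule nonzerodivisorD[OF q])
  then have "inverse rf_X ^ m * of_base a = 0" using s by simp
  then have "of_base a = 0" by (rule rf_X_power_cancel)
  then show ?thesis by simp
qed

lemma poly_at_inv_inverse:
  assumes "nonzerodivisor q"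
  shows "poly_at_inv q * inverse (poly_at_inv q) = 1"
proof -
  obtain r n where r: "of_base r = rf_X ^ n * poly_at_inv q" using ex_reversed_poly by blast
  have "nonzerodivisor r"
  proof (rule nonzerodivisorI)
    fix x assume "r * x = 0"
    then have "of_base r * of_base x = 0" by (simp flip: of_base_mult)
    then have "rf_X ^ n * (poly_at_inv q * of_base x) = 0" by (simp add: r mult.assoc)
    then have "poly_at_inv q * of_base x = 0" by (rule rf_X_power_cancel)
    then show "x = 0" by (rule poly_at_inv_regular[OF assms])
  qed
  then have *: "poly_at_inv q * (rf_X ^ n * inverse (of_base r)) = 1"
    using of_base_inverse(1)[of r] by (simp add: r mult_ac)
  then show ?thesis using inverse_total_fract_unique[OF *] by simp
qed

lemma invert_var_divide:
  assumes q: "nonzerodivisor q"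
  shows "invert_var (of_base p / of_base q) = poly_at_inv p / poly_at_inv q"
  unfolding invert_var_def
proof (rule the_equality)
  show "\<exists>p' q'. nonzerodivisor q' \<and> of_base p / of_base q = of_base p' / of_base q' \<and>
      poly_at_inv p / poly_at_inv q = poly_at_inv p' / poly_at_inv q'"
    using q by blast
next
  fix H
  assume "\<exists>p' q'. nonzerodivisor q' \<and> of_base p / of_base q = of_base p' / of_base q' \<and>
      H = poly_at_inv p' / poly_at_inv q'"
  then obtain p' q' where q': "nonzerodivisor q'"
    and eq: "of_base p / of_base q = of_base p' / of_base q'"
    and H: "H = poly_at_inv p' / poly_at_inv q'" by blast
  have "p * q' = p' * q"
    using eq q q' by (simp add: tfract_eq_iff flip: tfract_conv_divide)
  then have *: "poly_at_inv p * poly_at_inv q' = poly_at_inv p' * poly_at_inv q"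
    by (simp flip: poly_at_inv_mult)
  have "H = poly_at_inv p' * poly_at_inv q * inverse (poly_at_inv q) * inverse (poly_at_inv q')"
    using poly_at_inv_inverse[OF q] by (simp add: H divide_total_fract_def mult.assoc)
  also have "\<dots> = poly_at_inv p * (poly_at_inv q' * inverse (poly_at_inv q')) * inverse (poly_at_inv q)"
    unfolding *[symmetric] by (simp only: mult_ac)
  also have "\<dots> = poly_at_inv p * inverse (poly_at_inv q)"
    by (simp add: poly_at_inv_inverse[OF q'])
  finally show "H = poly_at_inv p / poly_at_inv q" by (simp add: divide_total_fract_def)
qed


subsection \<open>Rational functions given by power series\<close>

text \<open>
  The denominator is required to have constant coefficient \<open>1\<close>: a polynomial non-zero-divisor may
  be a zero divisor among power series, so for arbitrary denominators a power series need not
  determine the rational function.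
\<close>

definition ratfun_expands :: "'a::comm_ring_1 ratfun \<Rightarrow> 'a fps \<Rightarrow> bool" where
  "ratfun_expands F f \<longleftrightarrow> (\<exists>p q. coeff q 0 = 1 \<and> F = of_base p / of_base q \<and>
      fps_of_poly q * f = fps_of_poly p)"

definition ratfun_of_fps :: "'a::comm_ring_1 fps \<Rightarrow> 'a ratfun" where
  "ratfun_of_fps f = (THE F. ratfun_expands F f)"

lemma fps_of_poly_cancel:
  fixes q :: "'a::comm_ring_1 poly"
  assumes "coeff q 0 = 1" "fps_of_poly q * f = fps_of_poly q * g"
  shows "f = g"
proof -
  have "fps_left_inverse (fps_of_poly q) 1 * fps_of_poly q = 1"
    using assms(1) by (intro fps_left_inverse) simp
  moreover have "fps_left_inverse (fps_of_poly q) 1 * fps_of_poly q * f =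
      fps_left_inverse (fps_of_poly q) 1 * fps_of_poly q * g"
    using assms(2) by (simp only: mult.assoc)
  ultimately show ?thesis by simp
qed

lemma nonzerodivisor_coeff_0:
  fixes q :: "'a::comm_ring_1 poly"
  assumes "coeff q 0 = 1"
  shows "nonzerodivisor q"
proof (rule nonzerodivisorI)
  fix x assume "q * x = 0"
  then have "fps_of_poly q * fps_of_poly x = fps_of_poly q * 0"
    by (simp flip: fps_of_poly_mult)
  then have "fps_of_poly x = 0" by (rule fps_of_poly_cancel[OF assms])
  then show "x = 0" by (metis fps_of_poly_0 fps_of_poly_eq_iff)
qed

lemma ratfun_expands_unique:
  assumes "ratfun_expands F f" "ratfun_expands G f"
  shows "F = G"
proof -
  obtain p q where F: "coeff q 0 = 1" "F = of_base p / of_base q" "fps_of_poly q * f = fps_of_poly p"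
    using assms(1) by (auto simp: ratfun_expands_def)
  obtain r s where G: "coeff s 0 = 1" "G = of_base r / of_base s" "fps_of_poly s * f = fps_of_poly r"
    using assms(2) by (auto simp: ratfun_expands_def)
  have "fps_of_poly (p * s) = fps_of_poly (r * q)"
    by (simp add: fps_of_poly_mult mult_ac flip: F(3) G(3))
  then have "p * s = r * q" by (simp only: fps_of_poly_eq_iff)
  then show ?thesis
    using F(1,2) G(1,2) nonzerodivisor_coeff_0[of q] nonzerodivisor_coeff_0[of s]
    by (simp add: tfract_eq_iff flip: tfract_conv_divide)
qed

lemma ratfun_of_fps_eq: "ratfun_expands F f \<Longrightarrow> ratfun_of_fps f = F"
  unfolding ratfun_of_fps_def by (blast intro: the_equality ratfun_expands_unique)


section \<open>Half-open lattice simplices\<close>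

text \<open>
  The group is an arbitrary type of class \<^class>\<open>ab_group_add\<close>, hence written additively; its
  group ring over \<open>'r\<close> is \<open>'g \<Rightarrow>\<^sub>0 'r\<close> with the convolution product, and \<open>grp g\<close> is the
  group element \<open>g\<close> regarded as an element of the group ring.
\<close>

definition grp :: "'g::ab_group_add \<Rightarrow> 'g \<Rightarrow>\<^sub>0 'r::comm_ring_1" where
  "grp g = Poly_Mapping.single g 1"

definition real_vec :: "int ^ 'n \<Rightarrow> real ^ 'n" where
  "real_vec x = (\<chi> i. real_of_int (x $ i))"

text \<open>
  A half-open simplex is given by its vertices \<open>v 1, \<dots>, v (d + 1)\<close>, where \<open>d = CARD('n)\<close>, and
  the set \<open>S\<close> of those indices \<open>i\<close> for which the facet opposite to \<open>v i\<close> is removed.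
\<close>

definition lattice_simplex :: "(nat \<Rightarrow> int ^ 'n::finite) \<Rightarrow> bool" where
  "lattice_simplex v \<longleftrightarrow>
     inj_on v {1..CARD('n) + 1} \<and>
     \<not> affine_dependent ((\<lambda>i. real_vec (v i)) ` {1..CARD('n) + 1})"

text \<open>The dilate \<open>n\<Delta>\<close>; the half-open simplex \<open>\<Delta>\<close> itself is the case \<open>n = 1\<close>.\<close>

definition half_open_dilate ::
  "(nat \<Rightarrow> int ^ 'n::finite) \<Rightarrow> nat set \<Rightarrow> nat \<Rightarrow> (real ^ 'n) set" where
  "half_open_dilate v S n =
     {\<Sum>i\<in>{1..CARD('n) + 1}. l i *\<^sub>R real_vec (v i) | l.
        (\<Sum>i\<in>{1..CARD('n) + 1}. l i) = real n \<and>
        (\<forall>i\<in>{1..CARD('n) + 1}. if i \<in> S then 0 < l i else 0 \<le> l i)}"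

definition fund_parallelepiped ::
  "(nat \<Rightarrow> int ^ 'n::finite) \<Rightarrow> nat set \<Rightarrow> ((real ^ 'n) \<times> real) set" where
  "fund_parallelepiped v S =
     {\<Sum>i\<in>{1..CARD('n) + 1}. l i *\<^sub>R (real_vec (v i), 1) | l.
        \<forall>i\<in>{1..CARD('n) + 1}. if i \<in> S then 0 < l i \<and> l i \<le> 1 else 0 \<le> l i \<and> l i < 1}"

text \<open>The last coordinate \<open>m\<close> of a point of the parallelepiped is non-negative.\<close>

definition hstar ::
  "(nat \<Rightarrow> int ^ 'n::finite) \<Rightarrow> nat set \<Rightarrow> (int ^ 'n \<Rightarrow> 'g::ab_group_add) \<Rightarrow>
     ('g \<Rightarrow>\<^sub>0 'r::comm_ring_1) poly" where
  "hstar v S \<phi> =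
     (\<Sum>(\<beta>, m) \<in> {(\<beta>, m). (real_vec \<beta>, real_of_int m) \<in> fund_parallelepiped v S}.
        monom (grp (\<phi> \<beta>)) (nat m))"

definition ehrhart_series ::
  "(nat \<Rightarrow> int ^ 'n::finite) \<Rightarrow> nat set \<Rightarrow> (int ^ 'n \<Rightarrow> 'g::ab_group_add) \<Rightarrow>
     ('g \<Rightarrow>\<^sub>0 'r::comm_ring_1) fps" where
  "ehrhart_series v S \<phi> =
     Abs_fps (\<lambda>n. \<Sum>\<alpha> \<in> {\<alpha>. real_vec \<alpha> \<in> half_open_dilate v S n}. grp (\<phi> \<alpha>))"

text \<open>
  The rational function represented by the Ehrhart series; see \<open>ehrhart_ratfun_eq\<close> below.
\<close>

definition ehrhart_ratfun ::
  "(nat \<Rightarrow> int ^ 'n::finite) \<Rightarrow> nat set \<Rightarrow> (int ^ 'n \<Rightarrow> 'g::ab_group_add) \<Rightarrow>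
     ('g \<Rightarrow>\<^sub>0 'r::comm_ring_1) ratfun" where
  "ehrhart_ratfun v S \<phi> = ratfun_of_fps (ehrhart_series v S \<phi>)"


subsection \<open>Rationality of the Ehrhart series\<close>

lemma grp_add: "grp (a + b) = grp a * grp b"
  by (simp add: grp_def mult_single)

text \<open>
  The regions \<open>region v S J n\<close> interpolate between the dilates (\<open>J = {}\<close>) and the slices of the
  parallelepiped (\<open>J\<close> the set of all indices): coefficients with index in \<open>J\<close> are bounded by \<open>1\<close>.
\<close>

definition region_coeffs ::
  "(nat \<Rightarrow> int ^ 'n::finite) \<Rightarrow> nat set \<Rightarrow> nat set \<Rightarrow> int \<Rightarrow> int ^ 'n \<Rightarrow> (nat \<Rightarrow> real) \<Rightarrow> bool"
  where
  "region_coeffs v S J n \<alpha> l \<longleftrightarrow>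
     real_vec \<alpha> = (\<Sum>i\<in>{1..CARD('n) + 1}. l i *\<^sub>R real_vec (v i)) \<and>
     (\<Sum>i\<in>{1..CARD('n) + 1}. l i) = real_of_int n \<and>
     (\<forall>i\<in>{1..CARD('n) + 1}. if i \<in> S then 0 < l i else 0 \<le> l i) \<and>
     (\<forall>i\<in>{1..CARD('n) + 1} \<inter> J. if i \<in> S then l i \<le> 1 else l i < 1)"

definition region ::
  "(nat \<Rightarrow> int ^ 'n::finite) \<Rightarrow> nat set \<Rightarrow> nat set \<Rightarrow> int \<Rightarrow> (int ^ 'n) set" where
  "region v S J n = {\<alpha>. \<exists>l. region_coeffs v S J n \<alpha> l}"

lemma lattice_simplex_unique:
  fixes v :: "nat \<Rightarrow> int ^ 'n::finite"
  assumes v: "lattice_simplex v"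
    and eq: "(\<Sum>i\<in>{1..CARD('n) + 1}. l i *\<^sub>R real_vec (v i)) =
             (\<Sum>i\<in>{1..CARD('n) + 1}. l' i *\<^sub>R real_vec (v i))"
    and sum: "sum l {1..CARD('n) + 1} = sum l' {1..CARD('n) + 1}"
    and i: "i \<in> {1..CARD('n) + 1}"
  shows "l i = l' i"
proof (rule ccontr)
  assume neq: "l i \<noteq> l' i"
  define I where "I = {1..CARD('n) + 1}"
  define f where "f = (\<lambda>i. real_vec (v i))"
  have "inj (real_vec :: int ^ 'n \<Rightarrow> _)"
    by (rule injI) (simp add: real_vec_def vec_eq_iff)
  then have inj: "inj_on f I"
    using v by (auto simp: lattice_simplex_def f_def I_def inj_on_def inj_def)
  define U where "U = (\<lambda>x. l (the_inv_into I f x) - l' (the_inv_into I f x))"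
  have U: "U (f j) = l j - l' j" if "j \<in> I" for j
    using that inj by (simp add: U_def the_inv_into_f_f)
  have "sum U (f ` I) = 0"
    using sum[folded I_def] by (simp add: sum.reindex[OF inj] U sum_subtractf)
  moreover have "(\<Sum>x\<in>f ` I. U x *\<^sub>R x) = 0"
    using eq[folded I_def]
    by (simp add: sum.reindex[OF inj] U sum_subtractf scaleR_left_diff_distrib)
      (simp add: f_def)
  moreover have "\<exists>x\<in>f ` I. U x \<noteq> 0"
    using i[folded I_def] neq U by auto
  ultimately have "affine_dependent (f ` I)"
    by (subst affine_dependent_explicit_finite) (auto simp: I_def)
  then show False using v by (simp add: lattice_simplex_def f_def I_def)
qed

lemma finite_bounded_int_vec: "finite {x :: int ^ 'n::finite. \<forall>k. \<bar>x $ k\<bar> \<le> M}"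
proof -
  have "{x :: int ^ 'n. \<forall>k. \<bar>x $ k\<bar> \<le> M} \<subseteq> (\<lambda>f. \<chi> k. f k) ` (PiE UNIV (\<lambda>_. {- M..M}))"
  proof
    fix x :: "int ^ 'n" assume x: "x \<in> {x. \<forall>k. \<bar>x $ k\<bar> \<le> M}"
    have "- M \<le> x $ k \<and> x $ k \<le> M" for k
      using x by (simp add: abs_le_iff) (metis minus_le_iff)
    then have "(\<lambda>k. x $ k) \<in> PiE UNIV (\<lambda>_. {- M..M})" by auto
    moreover have "x = (\<chi> k. x $ k)" by (simp add: vec_eq_iff)
    ultimately show "x \<in> (\<lambda>f. \<chi> k. f k) ` (PiE UNIV (\<lambda>_. {- M..M}))" by blast
  qed
  then show ?thesis by (rule finite_subset) (intro finite_imageI finite_PiE; simp)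
qed

lemma region_coeffs_sums:
  fixes v :: "nat \<Rightarrow> int ^ 'n::finite"
  assumes "region_coeffs v S J n \<alpha> l"
  shows "real_vec \<alpha> = (\<Sum>i\<in>{1..CARD('n) + 1}. l i *\<^sub>R real_vec (v i))"
    and "sum l {1..CARD('n) + 1} = real_of_int n"
  using assms unfolding region_coeffs_def by blast+

lemma region_coeffs_nonneg:
  fixes v :: "nat \<Rightarrow> int ^ 'n::finite"
  assumes "region_coeffs v S J n \<alpha> l" "i \<in> {1..CARD('n) + 1}"
  shows "0 \<le> l i"
proof -
  have "if i \<in> S then 0 < l i else 0 \<le> l i"
    using assms unfolding region_coeffs_def by blast
  then show ?thesis by (simp split: if_splits)
qed

lemma region_coeffs_le:
  fixes v :: "nat \<Rightarrow> int ^ 'n::finite"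
  assumes "region_coeffs v S J n \<alpha> l" "i \<in> {1..CARD('n) + 1}"
  shows "l i \<le> real_of_int n"
proof -
  have "l i \<le> sum l {1..CARD('n) + 1}"
    using assms(2) by (rule member_le_sum) (use region_coeffs_nonneg[OF assms(1)] in auto)
  also have "\<dots> = n" using assms(1) unfolding region_coeffs_def by blast
  finally show ?thesis .
qed

lemma finite_region:
  fixes v :: "nat \<Rightarrow> int ^ 'n::finite"
  shows "finite (region v S J n)"
proof (rule finite_subset[OF _ finite_bounded_int_vec])
  let ?M = "\<Sum>i\<in>{1..CARD('n) + 1}. \<Sum>k\<in>UNIV. \<bar>n\<bar> * \<bar>v i $ k\<bar>"
  show "region v S J n \<subseteq> {x. \<forall>k. \<bar>x $ k\<bar> \<le> ?M}"
  proof (intro subsetI CollectI allI)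
    fix \<alpha> k assume "\<alpha> \<in> region v S J n"
    then obtain l where l: "region_coeffs v S J n \<alpha> l" by (auto simp: region_def)
    have "real_vec \<alpha> = (\<Sum>i\<in>{1..CARD('n) + 1}. l i *\<^sub>R real_vec (v i))"
      using l unfolding region_coeffs_def by blast
    then have "real_vec \<alpha> $ k = (\<Sum>i\<in>{1..CARD('n) + 1}. l i *\<^sub>R real_vec (v i)) $ k"
      by simp
    then have "real_of_int (\<alpha> $ k) = (\<Sum>i\<in>{1..CARD('n) + 1}. l i * real_of_int (v i $ k))"
      by (simp add: real_vec_def del: sum.cl_ivl_Suc)
    then have "\<bar>real_of_int (\<alpha> $ k)\<bar> \<le> (\<Sum>i\<in>{1..CARD('n) + 1}. \<bar>l i * real_of_int (v i $ k)\<bar>)"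
      by (simp only: sum_abs)
    also have "\<dots> \<le> (\<Sum>i\<in>{1..CARD('n) + 1}. \<Sum>k\<in>UNIV. real_of_int (\<bar>n\<bar> * \<bar>v i $ k\<bar>))"
    proof (rule sum_mono)
      fix i assume i: "i \<in> {1..CARD('n) + 1}"
      have "\<bar>l i * real_of_int (v i $ k)\<bar> \<le> \<bar>real_of_int n\<bar> * \<bar>real_of_int (v i $ k)\<bar>"
        using region_coeffs_nonneg[OF l i] region_coeffs_le[OF l i]
        by (simp add: abs_mult mult_right_mono)
      also have "\<dots> = real_of_int (\<bar>n\<bar> * \<bar>v i $ k\<bar>)" by simp
      also have "\<dots> \<le> (\<Sum>k\<in>UNIV. real_of_int (\<bar>n\<bar> * \<bar>v i $ k\<bar>))"
        by (rule member_le_sum) auto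
      finally show "\<bar>l i * real_of_int (v i $ k)\<bar> \<le> \<dots>" .
    qed
    also have "\<dots> = real_of_int ?M" by (simp only: of_int_sum)
    finally show "\<bar>\<alpha> $ k\<bar> \<le> ?M" by linarith
  qed
qed

lemma region_neg: "n < 0 \<Longrightarrow> region v S J n = {}"
proof (rule equals0I)
  fix \<alpha> assume n: "n < 0" and "\<alpha> \<in> region v S J n"
  then obtain l where l: "region_coeffs v S J n \<alpha> l" by (auto simp: region_def)
  have "0 \<le> l 1" "l 1 \<le> real_of_int n"
    using region_coeffs_nonneg[OF l] region_coeffs_le[OF l] by auto
  with n show False by linarith
qed

lemma region_coeffs_shift:
  fixes v :: "nat \<Rightarrow> int ^ 'n::finite"
  assumes l: "region_coeffs v S J n \<alpha> l" and j: "j \<in> {1..CARD('n) + 1}" "j \<notin> J"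
    and c: "if j \<in> S then 0 < l j + of_int c else 0 \<le> l j + of_int c"
  shows "region_coeffs v S J (n + c) (\<alpha> + (\<chi> k. c * v j $ k)) (l(j := l j + of_int c))"
proof -
  define I where "I = {1..CARD('n) + 1}"
  have I: "finite I" "j \<in> I" using j by (simp_all add: I_def)
  let ?l = "l(j := l j + of_int c)"
  have *: "(\<Sum>i\<in>I. g (?l i) i) = (\<Sum>i\<in>I. g (l i) i) + (g (l j + of_int c) j - g (l j) j)"
    for g :: "real \<Rightarrow> nat \<Rightarrow> 'b::real_vector"
  proof -
    have "(\<Sum>i\<in>I - {j}. g (?l i) i) = (\<Sum>i\<in>I - {j}. g (l i) i)"
      by (rule sum.cong) auto
    then show ?thesis using I by (simp add: sum.remove[of I j])
  qed
  have "real_vec (\<alpha> + (\<chi> k. c * v j $ k)) = real_vec \<alpha> + of_int c *\<^sub>R real_vec (v j)"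
    by (simp add: real_vec_def vec_eq_iff)
  then have 1: "real_vec (\<alpha> + (\<chi> k. c * v j $ k)) = (\<Sum>i\<in>I. ?l i *\<^sub>R real_vec (v i))"
    unfolding *[of "\<lambda>x i. x *\<^sub>R real_vec (v i)"] region_coeffs_sums(1)[OF l, folded I_def]
    by (simp only: scaleR_left_distrib add_diff_cancel_left')
  have 2: "sum ?l I = of_int (n + c)"
    unfolding *[of "\<lambda>x i. x"] region_coeffs_sums(2)[OF l, folded I_def] by simp
  show ?thesis
    unfolding region_coeffs_def I_def[symmetric]
  proof (intro conjI ballI 1 2)
    fix i assume i: "i \<in> I"
    have "if i \<in> S then 0 < l i else 0 \<le> l i"
      using l i unfolding region_coeffs_def I_def by blast
    then show "if i \<in> S then 0 < ?l i else 0 \<le> ?l i"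
      using c by (cases "i = j") simp_all
  next
    fix i assume i: "i \<in> I \<inter> J"
    then have "if i \<in> S then l i \<le> 1 else l i < 1"
      using l unfolding region_coeffs_def I_def by blast
    then show "if i \<in> S then ?l i \<le> 1 else ?l i < 1"
      using i j by (cases "i = j") simp_all
  qed
qed

lemma region_split:
  fixes v :: "nat \<Rightarrow> int ^ 'n::finite"
  assumes v: "lattice_simplex v" and j: "j \<in> {1..CARD('n) + 1}" "j \<notin> J"
  shows "region v S J n = region v S (insert j J) n \<union> (+) (v j) ` region v S J (n - 1)"
    and "region v S (insert j J) n \<inter> (+) (v j) ` region v S J (n - 1) = {}"
proof -
  show "region v S J n = region v S (insert j J) n \<union> (+) (v j) ` region v S J (n - 1)"
  proof (intro equalityI subsetI)
    fix \<alpha> assume "\<alpha> \<in> region v S J n"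
    then obtain l where l: "region_coeffs v S J n \<alpha> l" by (auto simp: region_def)
    show "\<alpha> \<in> region v S (insert j J) n \<union> (+) (v j) ` region v S J (n - 1)"
    proof (cases "if j \<in> S then l j \<le> 1 else l j < 1")
      case True
      then have "region_coeffs v S (insert j J) n \<alpha> l"
        using l unfolding region_coeffs_def by auto
      then show ?thesis by (auto simp: region_def)
    next
      case False
      then have "if j \<in> S then 0 < l j + of_int (- 1) else 0 \<le> l j + of_int (- 1)"
        by (auto split: if_splits)
      from region_coeffs_shift[OF l j this]
      have "\<alpha> + (\<chi> k. (- 1) * v j $ k) \<in> region v S J (n - 1)"
        by (auto simp: region_def)
      moreover have "\<alpha> = v j + (\<alpha> + (\<chi> k. (- 1) * v j $ k))"
        by (simp add: vec_eq_iff)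
      ultimately show ?thesis by blast
    qed
  next
    fix \<alpha> assume "\<alpha> \<in> region v S (insert j J) n \<union> (+) (v j) ` region v S J (n - 1)"
    then show "\<alpha> \<in> region v S J n"
    proof
      assume "\<alpha> \<in> region v S (insert j J) n"
      then show ?thesis by (auto simp: region_def region_coeffs_def)
    next
      assume "\<alpha> \<in> (+) (v j) ` region v S J (n - 1)"
      then obtain \<beta> l where \<beta>: "\<alpha> = v j + \<beta>" and l: "region_coeffs v S J (n - 1) \<beta> l"
        by (auto simp: region_def)
      have "if j \<in> S then 0 < l j + of_int 1 else 0 \<le> l j + of_int 1"
        using region_coeffs_nonneg[OF l j(1)] by simp
      from region_coeffs_shift[OF l j this]
      have "\<beta> + (\<chi> k. 1 * v j $ k) \<in> region v S J n"
        by (auto simp: region_def)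
      moreover have "\<alpha> = \<beta> + (\<chi> k. 1 * v j $ k)"
        by (simp add: vec_eq_iff \<beta>)
      ultimately show ?thesis by simp
    qed
  qed
  show "region v S (insert j J) n \<inter> (+) (v j) ` region v S J (n - 1) = {}"
  proof (rule equals0I)
    fix \<alpha> assume "\<alpha> \<in> region v S (insert j J) n \<inter> (+) (v j) ` region v S J (n - 1)"
    then obtain \<beta> l l' where \<beta>: "\<alpha> = v j + \<beta>" and l: "region_coeffs v S J (n - 1) \<beta> l"
      and l': "region_coeffs v S (insert j J) n \<alpha> l'"
      by (auto simp: region_def)
    have c: "if j \<in> S then 0 < l j + of_int 1 else 0 \<le> l j + of_int 1"
      using region_coeffs_nonneg[OF l j(1)] by simp
    have \<alpha>: "\<alpha> = \<beta> + (\<chi> k. 1 * v j $ k)" by (simp add: vec_eq_iff \<beta>)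
    have L: "region_coeffs v S J n \<alpha> (l(j := l j + of_int 1))"
      using region_coeffs_shift[OF l j c] by (simp add: \<alpha>)
    define l'' where "l'' = l(j := l j + of_int 1)"
    have "l' j = l'' j"
    proof (rule lattice_simplex_unique[OF v _ _ j(1), of l' l''])
      show "(\<Sum>i\<in>{1..CARD('n) + 1}. l' i *\<^sub>R real_vec (v i)) =
          (\<Sum>i\<in>{1..CARD('n) + 1}. l'' i *\<^sub>R real_vec (v i))"
        using region_coeffs_sums(1)[OF L] region_coeffs_sums(1)[OF l'] unfolding l''_def by metis
      show "sum l' {1..CARD('n) + 1} = sum l'' {1..CARD('n) + 1}"
        using region_coeffs_sums(2)[OF L] region_coeffs_sums(2)[OF l'] unfolding l''_def by metis
    qed
    then have eq: "l' j = l j + 1" by (simp add: l''_def)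
    have "if j \<in> S then 0 < l j else 0 \<le> l j"
      using l j unfolding region_coeffs_def by blast
    moreover have "if j \<in> S then l' j \<le> 1 else l' j < 1"
      using l' j unfolding region_coeffs_def by blast
    ultimately show False using eq by (simp split: if_splits)
  qed
qed

definition region_series ::
  "(nat \<Rightarrow> int ^ 'n::finite) \<Rightarrow> nat set \<Rightarrow> (int ^ 'n \<Rightarrow> 'g::ab_group_add) \<Rightarrow> nat set \<Rightarrow>
     ('g \<Rightarrow>\<^sub>0 'r::comm_ring_1) fps" where
  "region_series v S \<phi> J = Abs_fps (\<lambda>n. \<Sum>\<alpha> \<in> region v S J (int n). grp (\<phi> \<alpha>))"

lemma region_series_step:
  fixes v :: "nat \<Rightarrow> int ^ 'n::finite" and \<phi> :: "int ^ 'n \<Rightarrow> 'g::ab_group_add"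
  assumes v: "lattice_simplex v" and \<phi>: "\<And>a b. \<phi> (a + b) = \<phi> a + \<phi> b"
    and j: "j \<in> {1..CARD('n) + 1}" "j \<notin> J"
  shows "fps_of_poly (1 - monom (grp (\<phi> (v j))) 1) * region_series v S \<phi> J =
    (region_series v S \<phi> (insert j J) :: ('g \<Rightarrow>\<^sub>0 'r::comm_ring_1) fps)"
proof (rule fps_ext)
  fix n
  let ?g = "\<lambda>\<alpha>. grp (\<phi> \<alpha>) :: 'g \<Rightarrow>\<^sub>0 'r"
  have "(\<Sum>\<alpha>\<in>region v S J (int n). ?g \<alpha>) =
      (\<Sum>\<alpha>\<in>region v S (insert j J) (int n). ?g \<alpha>) +
      (\<Sum>\<alpha>\<in>(+) (v j) ` region v S J (int n - 1). ?g \<alpha>)"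
    by (subst region_split(1)[OF v j], subst sum.union_disjoint)
      (auto simp: finite_region region_split(2)[OF v j])
  also have "(\<Sum>\<alpha>\<in>(+) (v j) ` region v S J (int n - 1). ?g \<alpha>) =
      ?g (v j) * (\<Sum>\<alpha>\<in>region v S J (int n - 1). ?g \<alpha>)"
    by (subst sum.reindex) (simp_all add: \<phi> grp_add sum_distrib_left)
  finally have *: "(\<Sum>\<alpha>\<in>region v S (insert j J) (int n). ?g \<alpha>) =
      (\<Sum>\<alpha>\<in>region v S J (int n). ?g \<alpha>) - ?g (v j) * (\<Sum>\<alpha>\<in>region v S J (int n - 1). ?g \<alpha>)"
    by simp
  have X: "fps_of_poly (1 - monom (?g (v j)) 1) * region_series v S \<phi> J =
      region_series v S \<phi> J - fps_const (?g (v j)) * (fps_X * region_series v S \<phi> J)"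
    by (simp add: fps_of_poly_diff fps_of_poly_monom left_diff_distrib mult.assoc)
  show "fps_nth (fps_of_poly (1 - monom (?g (v j)) 1) * region_series v S \<phi> J) n =
      fps_nth (region_series v S \<phi> (insert j J)) n"
    unfolding X using * by (cases n) (simp_all add: region_series_def region_neg)
qed

lemma region_series_full:
  fixes v :: "nat \<Rightarrow> int ^ 'n::finite" and \<phi> :: "int ^ 'n \<Rightarrow> 'g::ab_group_add"
  assumes v: "lattice_simplex v" and \<phi>: "\<And>a b. \<phi> (a + b) = \<phi> a + \<phi> b"
    and J: "finite J" "J \<subseteq> {1..CARD('n) + 1}"
  shows "fps_of_poly (\<Prod>j\<in>J. 1 - monom (grp (\<phi> (v j))) 1) * region_series v S \<phi> {} =
    (region_series v S \<phi> J :: ('g \<Rightarrow>\<^sub>0 'r::comm_ring_1) fps)"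
  using J
proof (induction J rule: finite_induct)
  case empty
  then show ?case by simp
next
  case (insert j J)
  have "fps_of_poly (\<Prod>j\<in>insert j J. 1 - monom (grp (\<phi> (v j))) 1) * region_series v S \<phi> {} =
      fps_of_poly (1 - monom (grp (\<phi> (v j))) 1) * (region_series v S \<phi> J :: ('g \<Rightarrow>\<^sub>0 'r) fps)"
    using insert by (simp add: fps_of_poly_mult mult.assoc)
  also have "\<dots> = region_series v S \<phi> (insert j J)"
    using insert by (intro region_series_step[OF v \<phi>]) auto
  finally show ?case .
qed

lemma region_empty_eq: "region v S {} (int n) = {\<alpha>. real_vec \<alpha> \<in> half_open_dilate v S n}"
  by (auto simp: region_def region_coeffs_def half_open_dilate_def)

lemma region_full_eq:
  fixes v :: "nat \<Rightarrow> int ^ 'n::finite"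
  shows "\<alpha> \<in> region v S {1..CARD('n) + 1} m \<longleftrightarrow>
    (real_vec \<alpha>, real_of_int m) \<in> fund_parallelepiped v S"
proof -
  have 1: "(\<Sum>i\<in>I. l i *\<^sub>R (real_vec (v i), 1 :: real)) =
      (\<Sum>i\<in>I. l i *\<^sub>R real_vec (v i), sum l I)" for l and I :: "nat set"
    by (simp add: prod_eq_iff fst_sum snd_sum)
  have 2: "region_coeffs v S {1..CARD('n) + 1} m \<alpha> l \<longleftrightarrow>
     (real_vec \<alpha>, real_of_int m) = (\<Sum>i\<in>{1..CARD('n) + 1}. l i *\<^sub>R (real_vec (v i), 1)) \<and>
     (\<forall>i\<in>{1..CARD('n) + 1}. if i \<in> S then 0 < l i \<and> l i \<le> 1 else 0 \<le> l i \<and> l i < 1)" for l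
    unfolding region_coeffs_def 1 prod.inject by (auto split: if_splits)
  show ?thesis unfolding region_def fund_parallelepiped_def mem_Collect_eq 2 ..
qed

lemma region_full_le:
  fixes v :: "nat \<Rightarrow> int ^ 'n::finite"
  assumes "\<alpha> \<in> region v S {1..CARD('n) + 1} m"
  shows "0 \<le> m" "m \<le> int (CARD('n) + 1)"
proof -
  show "0 \<le> m" using assms region_neg[of m v S "{1..CARD('n) + 1}"] by (cases "m < 0") auto
  obtain l where l: "region_coeffs v S {1..CARD('n) + 1} m \<alpha> l"
    using assms by (auto simp: region_def)
  have "real_of_int m = sum l {1..CARD('n) + 1}"
    by (rule region_coeffs_sums(2)[OF l, symmetric])
  also have "\<dots> \<le> (\<Sum>i\<in>{1..CARD('n) + 1}. 1)"
  proof (rule sum_mono)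
    fix i assume "i \<in> {1..CARD('n) + 1}"
    then have "if i \<in> S then l i \<le> 1 else l i < 1"
      using l unfolding region_coeffs_def by blast
    then show "l i \<le> 1" by (simp split: if_splits)
  qed
  finally show "m \<le> int (CARD('n) + 1)" by simp
qed

lemma fund_parallelepiped_points:
  fixes v :: "nat \<Rightarrow> int ^ 'n::finite"
  shows "{(\<beta>, m). (real_vec \<beta>, real_of_int m) \<in> fund_parallelepiped v S} =
    (\<lambda>(n, \<beta>). (\<beta>, int n)) ` (SIGMA n:{..CARD('n) + 1}. region v S {1..CARD('n) + 1} (int n))"
proof (intro equalityI subsetI)
  fix x assume "x \<in> {(\<beta>, m). (real_vec \<beta>, real_of_int m) \<in> fund_parallelepiped v S}"
  then obtain \<beta> m where x: "x = (\<beta>, m)" and \<beta>: "\<beta> \<in> region v S {1..CARD('n) + 1} m"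
    unfolding region_full_eq by blast
  have "x = (\<lambda>(n, \<beta>). (\<beta>, int n)) (nat m, \<beta>)" "nat m \<le> CARD('n) + 1"
    "\<beta> \<in> region v S {1..CARD('n) + 1} (int (nat m))"
    using x \<beta> region_full_le[OF \<beta>] by simp_all
  then show "x \<in> (\<lambda>(n, \<beta>). (\<beta>, int n)) `
      (SIGMA n:{..CARD('n) + 1}. region v S {1..CARD('n) + 1} (int n))"
    by blast
next
  fix x assume "x \<in> (\<lambda>(n, \<beta>). (\<beta>, int n)) `
      (SIGMA n:{..CARD('n) + 1}. region v S {1..CARD('n) + 1} (int n))"
  then obtain n \<beta> where x: "x = (\<beta>, int n)" and \<beta>: "\<beta> \<in> region v S {1..CARD('n) + 1} (int n)"
    by auto
  show "x \<in> {(\<beta>, m). (real_vec \<beta>, real_of_int m) \<in> fund_parallelepiped v S}"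
    unfolding x mem_Collect_eq prod.case by (rule \<beta>[unfolded region_full_eq])
qed

lemma fps_of_poly_hstar:
  fixes v :: "nat \<Rightarrow> int ^ 'n::finite" and \<phi> :: "int ^ 'n \<Rightarrow> 'g::ab_group_add"
  shows "fps_of_poly (hstar v S \<phi>) =
    (region_series v S \<phi> {1..CARD('n) + 1} :: ('g \<Rightarrow>\<^sub>0 'r::comm_ring_1) fps)"
proof (rule fps_ext)
  fix k
  let ?R = "\<lambda>n. region v S {1..CARD('n) + 1} (int n)"
  let ?g = "\<lambda>\<alpha>. grp (\<phi> \<alpha>) :: 'g \<Rightarrow>\<^sub>0 'r"
  have "hstar v S \<phi> = (\<Sum>(n, \<beta>)\<in>(SIGMA n:{..CARD('n) + 1}. ?R n). monom (?g \<beta>) n)"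
    unfolding hstar_def fund_parallelepiped_points
    by (subst sum.reindex) (auto simp: inj_on_def case_prod_unfold)
  also have "\<dots> = (\<Sum>n\<le>CARD('n) + 1. \<Sum>\<beta>\<in>?R n. monom (?g \<beta>) n)"
    by (subst sum.Sigma) (auto simp: finite_region)
  finally have "coeff (hstar v S \<phi>) k = (\<Sum>n\<le>CARD('n) + 1. \<Sum>\<beta>\<in>?R n. if n = k then ?g \<beta> else 0)"
    by (simp add: coeff_sum)
  also have "\<dots> = (\<Sum>n\<le>CARD('n) + 1. if n = k then (\<Sum>\<beta>\<in>?R n. ?g \<beta>) else 0)"
    by (intro sum.cong) auto
  also have "\<dots> = (if k \<le> CARD('n) + 1 then (\<Sum>\<beta>\<in>?R k. ?g \<beta>) else 0)"
    by (subst sum.delta) auto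
  also have "\<dots> = (\<Sum>\<beta>\<in>?R k. ?g \<beta>)"
  proof -
    have "?R k = {}" if "\<not> k \<le> CARD('n) + 1"
      using that region_full_le(2)[of _ v S "int k"] by fastforce
    then show ?thesis by auto
  qed
  finally show "fps_nth (fps_of_poly (hstar v S \<phi>)) k =
      fps_nth (region_series v S \<phi> {1..CARD('n) + 1} :: ('g \<Rightarrow>\<^sub>0 'r) fps) k"
    by (simp add: region_series_def)
qed

lemma ehrhart_ratfun_eq:
  fixes v :: "nat \<Rightarrow> int ^ 'n::finite" and \<phi> :: "int ^ 'n \<Rightarrow> 'g::ab_group_add"
  assumes v: "lattice_simplex v" and \<phi>: "\<And>a b. \<phi> (a + b) = \<phi> a + \<phi> b"
  defines "D \<equiv> (\<Prod>i\<in>{1..CARD('n) + 1}. 1 - monom (grp (\<phi> (v i))) 1)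
    :: ('g \<Rightarrow>\<^sub>0 'r::comm_ring_1) poly"
  shows "ratfun_expands (of_base (hstar v S \<phi>) / of_base D) (ehrhart_series v S \<phi>)"
    and "ehrhart_ratfun v S \<phi> = of_base (hstar v S \<phi>) / of_base D"
proof -
  have "fps_of_poly D * ehrhart_series v S \<phi> = fps_of_poly (hstar v S \<phi>)"
    using region_series_full[OF v \<phi>, of "{1..CARD('n) + 1}" S, where 'r = 'r]
    by (simp add: fps_of_poly_hstar D_def ehrhart_series_def region_series_def region_empty_eq
        del: prod.cl_ivl_Suc)
  moreover have "coeff D 0 = 1"
    unfolding D_def by (simp add: poly_prod poly_monom del: prod.cl_ivl_Suc flip: poly_0_coeff_0)
  ultimately show *: "ratfun_expands (of_base (hstar v S \<phi>) / of_base D) (ehrhart_series v S \<phi>)"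
    unfolding ratfun_expands_def by blast
  show "ehrhart_ratfun v S \<phi> = of_base (hstar v S \<phi>) / of_base D"
    unfolding ehrhart_ratfun_def by (rule ratfun_of_fps_eq[OF *])
qed

end

(* The map (\<beta>, m) \<mapsto> (v 1 + ... + v (d + 1) - \<beta>, d + 1 - m) replaces each coefficient \<lambda> of a point
   of the fundamental parallelepiped by 1 - \<lambda>, hence exchanges the lattice points of the
   parallelepipeds of the simplex and of its complement; this is the first identity.  The second
   one follows on dividing by the denominators, since 1 - x t = - x t (1 - 1 / (x t)). *)
theory Submission
  imports Defs
begin

text \<open>The substitution \<lambda> \<mapsto> 1 - \<lambda> exchanges the intervals (0, 1] and
  [0, 1), so the strict bounds move to the complementary indices. One inclusion is enough, since the
  map is an involution.\<close>

lemma fund_parallelepiped_complement: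
  fixes v :: "nat \<Rightarrow> int ^ 'n::finite"
  assumes "(real_vec \<beta>, real_of_int m) \<in> fund_parallelepiped v S"
  shows "(real_vec ((\<Sum>i\<in>{1..CARD('n) + 1}. v i) - \<beta>), real_of_int (int (CARD('n) + 1) - m))
    \<in> fund_parallelepiped v ({1..CARD('n) + 1} - S)"
proof -
  define I where "I = {1..CARD('n) + 1}"
  obtain l where l: "(real_vec \<beta>, real_of_int m) = (\<Sum>i\<in>I. l i *\<^sub>R (real_vec (v i), 1))"
    and bounds: "\<forall>i\<in>I. if i \<in> S then 0 < l i \<and> l i \<le> 1 else 0 \<le> l i \<and> l i < 1"
    using assms unfolding fund_parallelepiped_def I_def by blast
  \<comment> \<open>The sum of all generators is \<open>(sum v I, d + 1)\<close>; subtracting the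
    given point from it turns each \<open>l i\<close> into \<open>1 - l i\<close>.\<close>
  have "real_vec (sum v I) = (\<Sum>i\<in>I. real_vec (v i))"
    by (simp add: real_vec_def vec_eq_iff)
  moreover have "real_vec (sum v I - \<beta>) = real_vec (sum v I) - real_vec \<beta>"
    by (simp add: real_vec_def vec_eq_iff)
  moreover have "card I = CARD('n) + 1"
    by (simp add: I_def)
  ultimately have "(real_vec (sum v I - \<beta>), real_of_int (int (CARD('n) + 1) - m)) =
      (\<Sum>i\<in>I. (real_vec (v i), 1)) - (real_vec \<beta>, real_of_int m)"
    by (simp add: prod_eq_iff fst_sum snd_sum)
  also have "\<dots> = (\<Sum>i\<in>I. (1 - l i) *\<^sub>R (real_vec (v i), 1))"
    unfolding l by (simp add: scaleR_left_diff_distrib sum_subtractf del: scaleR_Pair)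
  finally have eq: "(real_vec (sum v I - \<beta>), real_of_int (int (CARD('n) + 1) - m)) =
      (\<Sum>i\<in>I. (1 - l i) *\<^sub>R (real_vec (v i), 1))" .
  have "\<forall>i\<in>I. if i \<in> I - S then 0 < 1 - l i \<and> 1 - l i \<le> 1 else 0 \<le> 1 - l i \<and> 1 - l i < 1"
    using bounds by (auto split: if_splits)
  with eq show ?thesis
    unfolding fund_parallelepiped_def I_def[symmetric] mem_Collect_eq
    by (intro exI[of _ "\<lambda>i. 1 - l i"] conjI)
qed

text \<open>These bounds ensure that \<open>nat\<close> truncates neither the height nor its
  reflection \<open>d + 1 - m\<close>.\<close>

lemma fund_parallelepiped_height:
  fixes v :: "nat \<Rightarrow> int ^ 'n::finite"
  assumes "(real_vec \<beta>, real_of_int m) \<in> fund_parallelepiped v S"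
  shows "0 \<le> m" "m \<le> int (CARD('n) + 1)"
  using region_full_le[of \<beta> v S m] assms unfolding region_full_eq by blast+

text \<open>Over an infinite \<open>A\<close> both sides take the default value 0, so the rule
  applies to sums over lattice points without a separate finiteness argument.\<close>

lemma poly_at_inv_sum: "poly_at_inv (\<Sum>x\<in>A. f x) = (\<Sum>x\<in>A. poly_at_inv (f x))"
  by (induction A rule: infinite_finite_induct) (simp_all add: poly_at_inv_add)

lemma poly_at_inv_prod: "poly_at_inv (\<Prod>x\<in>A. f x) = (\<Prod>x\<in>A. poly_at_inv (f x))"
  by (induction A rule: infinite_finite_induct) (simp_all add: poly_at_inv_mult)

text \<open>Together with \<open>of_base_monom\<close>, this brings both sides of the first identity
  into the form constant times power of \<open>rf_X\<close>, ready for comparison term by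
  term.\<close>

lemma poly_at_inv_monom: "poly_at_inv (monom c k) = rf_const c * inverse rf_X ^ k"
  by (induction k) (simp_all add: monom_0 monom_Suc mult_ac)

lemma of_base_sum: "of_base (\<Sum>x\<in>A. f x) = (\<Sum>x\<in>A. of_base (f x))"
  by (induction A rule: infinite_finite_induct) (simp_all add: of_base_add)

lemma of_base_monom: "of_base (monom c k) = rf_const c * rf_X ^ k"
proof -
  have "monom c k = [:c:] * [:0, 1:] ^ k"
    by (simp add: monom_altdef)
  then show ?thesis
    by (simp only: of_base_mult of_base_power rf_const_def rf_X_def)
qed

lemma rf_X_power_diff:
  assumes "k \<le> n"
  shows "rf_X ^ n * inverse rf_X ^ k = (rf_X ^ (n - k) :: 'a::comm_ring_1 ratfun)"
proof -
  have "rf_X ^ n = (rf_X ^ (n - k) * rf_X ^ k :: 'a ratfun)"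
    using assms by (simp flip: power_add)
  then show ?thesis
    by (simp add: mult.assoc rf_X_power_inverse)
qed

text \<open>The point (\<beta>, m) contributes -\<phi>(\<beta>) at height -m on the right; the
  prefactor shifts this to \<phi>(V - \<beta>) at height N - m, which is the contribution of the
  reflected point on the left.\<close>

lemma hstar_complement:
  fixes v :: "nat \<Rightarrow> int ^ 'n::finite" and \<phi> :: "int ^ 'n \<Rightarrow> 'g::ab_group_add"
  assumes \<phi>: "\<And>\<alpha> \<beta>. \<phi> (\<alpha> + \<beta>) = \<phi> \<alpha> + \<phi> \<beta>" and S: "S \<subseteq> {1..CARD('n) + 1}"
  shows "(of_base (hstar v ({1..CARD('n) + 1} - S) \<phi>) :: ('g \<Rightarrow>\<^sub>0 'r::comm_ring_1) ratfun) =
    rf_const (grp (\<phi> (\<Sum>i\<in>{1..CARD('n) + 1}. v i))) * rf_X ^ (CARD('n) + 1) *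
      poly_at_inv (hstar v S (\<lambda>\<alpha>. - \<phi> \<alpha>))"
proof -
  define N where "N = CARD('n) + 1"
  define V where "V = (\<Sum>i\<in>{1..N}. v i)"
  define P where "P = (\<lambda>S. {(\<beta>, m). (real_vec \<beta>, real_of_int m) \<in> fund_parallelepiped v S})"
  define r where "r = (\<lambda>(\<beta>, m). (V - \<beta>, int N - m))"
  \<comment> \<open>Stated for every \<open>T\<close>, as it is used both for \<open>S\<close> and
    for its complement.\<close>
  have r_mem: "r x \<in> P ({1..N} - T)" if "x \<in> P T" for x T
    using that fund_parallelepiped_complement[of _ _ v T]
    by (auto simp: P_def r_def V_def N_def simp del: sum.cl_ivl_Suc)
  have rr: "r (r x) = x" for x
    by (simp add: r_def case_prod_unfold)
  \<comment> \<open>Here \<open>S\<close> must consist of vertex indices: in general the double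
    complement is only \<open>{1..N} \<inter> S\<close>.\<close>
  have SS: "{1..N} - ({1..N} - S) = S"
    using S by (auto simp: N_def)
  have term_eq: "(case r (\<beta>, m) of (\<beta>', m') \<Rightarrow> rf_const (grp (\<phi> \<beta>')) * rf_X ^ nat m') =
      rf_const (grp (\<phi> V)) * rf_X ^ N *
        (rf_const (grp (- \<phi> \<beta>)) * inverse rf_X ^ nat m :: ('g \<Rightarrow>\<^sub>0 'r) ratfun)"
    if "(\<beta>, m) \<in> P S" for \<beta> m
  proof -
    have m: "0 \<le> m" "m \<le> int N"
      using that fund_parallelepiped_height[of \<beta> m v S] by (simp_all add: P_def N_def)
    have "\<phi> (V - \<beta>) = \<phi> V + - \<phi> \<beta>"
      using \<phi>[of "V - \<beta>" \<beta>] by simp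
    then have g: "rf_const (grp (\<phi> (V - \<beta>))) =
        (rf_const (grp (\<phi> V)) * rf_const (grp (- \<phi> \<beta>)) :: ('g \<Rightarrow>\<^sub>0 'r) ratfun)"
      by (simp only: grp_add rf_const_simps)
    \<comment> \<open>Both height bounds enter: \<open>nat (int N - m)\<close> equals
      \<open>N - nat m\<close>, and the exponent does not exceed \<open>N\<close>.\<close>
    have X: "rf_X ^ nat (int N - m) = (rf_X ^ N * inverse rf_X ^ nat m :: ('g \<Rightarrow>\<^sub>0 'r) ratfun)"
      using m by (subst rf_X_power_diff) (auto simp: nat_diff_distrib)
    show ?thesis
      by (simp only: r_def prod.case g X mult_ac)
  qed
  have "of_base (hstar v ({1..N} - S) \<phi>) =
      (\<Sum>(\<beta>, m)\<in>P ({1..N} - S). rf_const (grp (\<phi> \<beta>)) * rf_X ^ nat m :: ('g \<Rightarrow>\<^sub>0 'r) ratfun)"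
    by (simp add: hstar_def P_def of_base_sum case_prod_unfold of_base_monom)
  \<comment> \<open>Being an involution, \<open>r\<close> is its own inverse and serves as the
    witness in both directions.\<close>
  also have "\<dots> = (\<Sum>x\<in>P S. case r x of (\<beta>, m) \<Rightarrow> rf_const (grp (\<phi> \<beta>)) * rf_X ^ nat m)"
  proof (rule sum.reindex_bij_witness[of _ r r])
    show "r x \<in> P S" if "x \<in> P ({1..N} - S)" for x
      using r_mem[OF that] by (simp only: SS)
  qed (use r_mem rr in auto)
  also have "\<dots> = (\<Sum>(\<beta>, m)\<in>P S. rf_const (grp (\<phi> V)) * rf_X ^ N *
      (rf_const (grp (- \<phi> \<beta>)) * inverse rf_X ^ nat m))"
    by (rule sum.cong) (use term_eq in auto)
  also have "\<dots> = rf_const (grp (\<phi> V)) * rf_X ^ N * poly_at_inv (hstar v S (\<lambda>\<alpha>. - \<phi> \<alpha>))"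
    by (simp add: hstar_def P_def poly_at_inv_sum case_prod_unfold poly_at_inv_monom
        sum_distrib_left)
  finally show ?thesis
    by (simp only: N_def V_def)
qed

text \<open>Splits the prefactor so that each vertex can pass its own group element to its own
  factor of the denominator.\<close>

lemma rf_const_grp_sum:
  fixes \<phi> :: "'a::comm_monoid_add \<Rightarrow> 'g::ab_group_add"
  assumes \<phi>: "\<And>\<alpha> \<beta>. \<phi> (\<alpha> + \<beta>) = \<phi> \<alpha> + \<phi> \<beta>"
  shows "rf_const (grp (\<phi> (\<Sum>i\<in>I. v i))) =
    (\<Prod>i\<in>I. rf_const (grp (\<phi> (v i))) :: ('g \<Rightarrow>\<^sub>0 'r::comm_ring_1) ratfun)"
proof -
  \<comment> \<open>Settles the empty and the infinite index set, where the sum is 0 and the product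
    is 1.\<close>
  have "\<phi> 0 = 0" using \<phi>[of 0 0] by simp
  moreover have "grp 0 = (1 :: 'g \<Rightarrow>\<^sub>0 'r)" by (simp add: grp_def)
  ultimately show ?thesis
    by (induction I rule: infinite_finite_induct) (simp_all add: \<phi> grp_add)
qed

text \<open>Each factor of the denominator absorbs one group element and one \<open>rf_X\<close> and
  changes sign, which accounts for the exponent \<open>card I\<close> of -1.\<close>

lemma denominator_reciprocity:
  fixes g :: "'i \<Rightarrow> 'g::ab_group_add"
  shows "(\<Prod>i\<in>I. rf_const (grp (g i))) * rf_X ^ card I *
      poly_at_inv (\<Prod>i\<in>I. 1 - monom (grp (- g i)) 1) =
    ((- 1) ^ card I * of_base (\<Prod>i\<in>I. 1 - monom (grp (g i)) 1)
      :: ('g \<Rightarrow>\<^sub>0 'r::comm_ring_1) ratfun)"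
proof -
  let ?c = "\<lambda>x :: 'g. rf_const (grp x) :: ('g \<Rightarrow>\<^sub>0 'r) ratfun"
  have factor: "?c x * rf_X * poly_at_inv (1 - monom (grp (- x)) 1) =
      - 1 * of_base (1 - monom (grp x) 1)" for x
  proof -
    have "?c x * ?c (- x) = rf_const (grp (x + - x))"
      by (simp only: grp_add rf_const_simps)
    also have "\<dots> = 1" by (simp add: grp_def)
    finally have unit: "?c x * ?c (- x) * (rf_X * inverse rf_X) = 1"
      by (simp add: rf_X_inverse)
    \<comment> \<open>The value at a difference is read off from additivity, applied to (1 - p) + p
      = 1.\<close>
    have p: "poly_at_inv (1 - monom (grp (- x)) 1) = 1 - ?c (- x) * inverse rf_X"
      using poly_at_inv_add[of "1 - monom (grp (- x)) 1" "monom (grp (- x)) 1"]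
      by (simp add: poly_at_inv_monom eq_diff_eq)
    have b: "of_base (1 - monom (grp x) 1) = 1 - ?c x * rf_X"
      using of_base_add[of "1 - monom (grp x) 1" "monom (grp x) 1"]
      by (simp add: of_base_monom eq_diff_eq)
    from unit show ?thesis unfolding p b by (simp add: algebra_simps)
  qed
  have "(\<Prod>i\<in>I. ?c (g i)) * rf_X ^ card I * poly_at_inv (\<Prod>i\<in>I. 1 - monom (grp (- g i)) 1) =
      (\<Prod>i\<in>I. ?c (g i) * rf_X * poly_at_inv (1 - monom (grp (- g i)) 1))"
    by (simp add: poly_at_inv_prod prod.distrib)
  also have "\<dots> = (\<Prod>i\<in>I. - 1 * of_base (1 - monom (grp (g i)) 1))"
    by (simp only: factor)
  also have "\<dots> = (- 1) ^ card I * of_base (\<Prod>i\<in>I. 1 - monom (grp (g i)) 1)"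
    by (simp only: prod.distrib prod_constant of_base_prod)
  finally show ?thesis .
qed

text \<open>The constant coefficient is 1, so the denominators are regular even if the coefficient
  ring has zero divisors.\<close>

lemma nonzerodivisor_denominator:
  "nonzerodivisor (\<Prod>i\<in>I. 1 - monom (c i) 1 :: 'a::comm_ring_1 poly)"
  by (rule nonzerodivisor_coeff_0) (simp add: poly_prod poly_monom flip: poly_0_coeff_0)

theorem mainTheorem3:
  fixes \<phi> :: "int ^ 'n::finite \<Rightarrow> 'g::ab_group_add"
    and v :: "nat \<Rightarrow> int ^ 'n"
    and S :: "nat set"
  assumes "\<And>\<alpha> \<beta>. \<phi> (\<alpha> + \<beta>) = \<phi> \<alpha> + \<phi> \<beta>"
    and "lattice_simplex v"
    and "S \<subseteq> {1..CARD('n) + 1}"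
  shows "(of_base (hstar v ({1..CARD('n) + 1} - S) \<phi>) :: ('g \<Rightarrow>\<^sub>0 'r::comm_ring_1) ratfun) =
      rf_const (grp (\<phi> (\<Sum>i\<in>{1..CARD('n) + 1}. v i))) * rf_X ^ (CARD('n) + 1) *
        poly_at_inv (hstar v S (\<lambda>\<alpha>. - \<phi> \<alpha>)) \<and>
    (invert_var (ehrhart_ratfun v S (\<lambda>\<alpha>. - \<phi> \<alpha>)) :: ('g \<Rightarrow>\<^sub>0 'r) ratfun) =
      (- 1) ^ (CARD('n) + 1) * ehrhart_ratfun v ({1..CARD('n) + 1} - S) \<phi>"
proof (intro conjI hstar_complement assms)
  define I where "I = {1..CARD('n) + 1}"
  define N where "N = CARD('n) + 1"
  \<comment> \<open>The factor \<open>u\<close> relates numerators and denominators alike, so it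
    cancels in the quotient and leaves only the sign.\<close>
  define u :: "('g \<Rightarrow>\<^sub>0 'r) ratfun" where "u = rf_const (grp (\<phi> (\<Sum>i\<in>I. v i))) * rf_X ^ N"
  define h :: "('g \<Rightarrow>\<^sub>0 'r) poly" where "h = hstar v S (\<lambda>\<alpha>. - \<phi> \<alpha>)"
  define h' :: "('g \<Rightarrow>\<^sub>0 'r) poly" where "h' = hstar v (I - S) \<phi>"
  define D :: "('g \<Rightarrow>\<^sub>0 'r) poly" where "D = (\<Prod>i\<in>I. 1 - monom (grp (- \<phi> (v i))) 1)"
  define D' :: "('g \<Rightarrow>\<^sub>0 'r) poly" where "D' = (\<Prod>i\<in>I. 1 - monom (grp (\<phi> (v i))) 1)"
  have h': "of_base h' = u * poly_at_inv h"
    unfolding h'_def h_def u_def I_def N_def by (rule hstar_complement[OF assms(1,3)])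
  have D': "u * poly_at_inv D = (- 1) ^ N * of_base D'"
    using denominator_reciprocity[of "\<lambda>i. \<phi> (v i)" I, where 'r = 'r]
    by (simp only: u_def D_def D'_def rf_const_grp_sum[of \<phi>, OF assms(1)])
      (simp add: I_def N_def del: prod.cl_ivl_Suc)
  have sign: "(- 1) ^ N * (- 1) ^ N = (1 :: ('g \<Rightarrow>\<^sub>0 'r) ratfun)"
    by (simp flip: power_mult_distrib)
  \<comment> \<open>The candidate inverse comes from solving \<open>D'\<close> for
    \<open>poly_at_inv D\<close>; the sign is its own inverse. Checking the product suffices because
    inverses are unique.\<close>
  have "poly_at_inv D * ((- 1) ^ N * u * inverse (of_base D')) =
      (- 1) ^ N * (u * poly_at_inv D) * inverse (of_base D')"
    by (simp only: mult_ac)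
  also have "\<dots> = (- 1) ^ N * (- 1) ^ N * (of_base D' * inverse (of_base D'))"
    by (simp only: D' mult_ac)
  also have "\<dots> = 1"
    by (simp only: sign of_base_inverse(1) nonzerodivisor_denominator D'_def mult_1)
  finally have inv: "inverse (poly_at_inv D) = (- 1) ^ N * u * inverse (of_base D')"
    by (rule inverse_total_fract_unique)
  \<comment> \<open>Additivity of the negated map makes the quotient formula for the Ehrhart series
    available for \<phi>' as well.\<close>
  have neg: "- \<phi> (\<alpha> + \<beta>) = - \<phi> \<alpha> + - \<phi> \<beta>" for \<alpha> \<beta>
    by (simp add: assms(1))
  have "invert_var (ehrhart_ratfun v S (\<lambda>\<alpha>. - \<phi> \<alpha>)) = poly_at_inv h / poly_at_inv D"
    unfolding ehrhart_ratfun_eq(2)[OF assms(2) neg] h_def D_def I_def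
    by (rule invert_var_divide) (rule nonzerodivisor_denominator)
  \<comment> \<open>The \<open>u\<close> from the inverted denominator combines with
    \<open>poly_at_inv h\<close> to give \<open>h'\<close>.\<close>
  also have "\<dots> = (- 1) ^ N * (of_base h' / of_base D')"
    by (simp only: divide_total_fract_def inv h' mult_ac)
  also have "of_base h' / of_base D' = ehrhart_ratfun v (I - S) \<phi>"
    unfolding ehrhart_ratfun_eq(2)[OF assms(2,1)] h'_def D'_def I_def ..
  finally show "invert_var (ehrhart_ratfun v S (\<lambda>\<alpha>. - \<phi> \<alpha>)) =
      ((- 1) ^ (CARD('n) + 1) * ehrhart_ratfun v ({1..CARD('n) + 1} - S) \<phi>
        :: ('g \<Rightarrow>\<^sub>0 'r) ratfun)"
    by (simp only: I_def N_def)
qed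

end
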